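(* Let $\mathcal A$ and $\mathcal B$ be bracket signatures. If $\mathcal A$ contains $\mathcal B$, and the bracket $\mathcal B$ is not ordered, then the bracket $\mathcal A$ is not ordered either.
   Context: Teams $t_1,\dots,t_n$ are given in seed order; smaller numbers are higher seeds. A matchup table is a matrix $p_{ij}=\mathbb P[t_i\text{ beats }t_j]\in[0,1]$ with $p_{ij}+p_{ji}=1$ (so $p_{ii}=1/2$); game outcomes are independent. The list of teams is strongly stochastically transitive (SST) if $p_{ij}\le p_{ik}$ for all $i,j,k$ with $j<k$. A bracket on $n\ge1$ teams is a full binary tree (children unordered) whose $n$ leaves are labelled bijectively by the seeds $1,\dots,n$. Team $t_i$ begins at the leaf labelled $i$. Each internal node is a game between the teams arriving from its two children; the winner moves up and the loser plays no more games; the team reaching the root is the champion. If the tree has height $r$, there are $r$ rounds: the games at distance $d$ from the root form round $r-d$. A team has a bye in round $s$ if it plays no game in round $s$ or before; a team whose leaf is at distance $d$ from the root has $r-d$ byes. The signature of an $r$-round bracket is $[[a_0;\dots;a_r]]$, where $a_i$ is the number of teams with exactly $i$ byes; the number of games in each round is determined by the signature. A bracket goes chalk if the higher-seeded team (smaller number) wins every game. A bracket is proper if, when it goes chalk, for every round and all $i<j$ with $t_i,t_j$ not having lost before that round: if $t_j$ has a bye in that round then so does $t_i$, and if both play in that round then the opponent of $t_i$ has a larger seed number than the opponent of $t_j$. There is exactly one proper bracket with each bracket signature, and "the bracket $\mathcal A$" for a signature $\mathcal A$ means the proper bracket with that signature. $\mathcal A$ contains $\mathcal B$ if there exists some $i\ge0$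 such that (a) at least as many games are played in the $(i+1)$th round of $\mathcal A$ as in the first round of $\mathcal B$, and (b) for $1<j\le r$, where $r$ is the number of rounds in $\mathcal B$, there are exactly as many games played in the $(i+j)$th round of $\mathcal A$ as in the $j$th round of $\mathcal B$. An $n$-team tournament format is ordered if for every SST list of $n$ teams and all $i<j$, the probability that $t_i$ is champion is at least the probability that $t_j$ is champion. *)

theory Defs
  imports "HOL-Probability.Probability_Mass_Function"
begin

(* The order of the two children carries no meaning: every notion below is
   invariant under swapping the arguments of Game. *)
datatype bracket = Team nat | is_Game: Game bracket bracket

primrec leaves :: "bracket \<Rightarrow> nat list" where
  "leaves (Team i) = [i]"
| "leaves (Game l r) = leaves l @ leaves r"

definition teams :: "bracket \<Rightarrow> nat set" where
  "teams T = set (leaves T)"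

definition num_teams :: "bracket \<Rightarrow> nat" where
  "num_teams T = length (leaves T)"

definition is_bracket :: "bracket \<Rightarrow> bool" where
  "is_bracket T \<longleftrightarrow> distinct (leaves T) \<and> teams T = {1..num_teams T}"

primrec rounds :: "bracket \<Rightarrow> nat" where
  "rounds (Team i) = 0"
| "rounds (Game l r) = Suc (max (rounds l) (rounds r))"

primrec leaf_depth :: "bracket \<Rightarrow> nat \<Rightarrow> nat" where
  "leaf_depth (Team j) i = 0"
| "leaf_depth (Game l r) i = Suc (if i \<in> teams l then leaf_depth l i else leaf_depth r i)"

definition byes :: "bracket \<Rightarrow> nat \<Rightarrow> nat" where
  "byes T i = rounds T - leaf_depth T i"

(* The first game of team i is the parent of its leaf, hence is played in round byes T i + 1. *)
definition has_bye :: "bracket \<Rightarrow> nat \<Rightarrow> nat \<Rightarrow> bool" where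
  "has_bye T s i \<longleftrightarrow> s \<le> byes T i"

fun subtrees_at :: "nat \<Rightarrow> bracket \<Rightarrow> bracket list" where
  "subtrees_at 0 T = [T]"
| "subtrees_at (Suc d) (Team i) = []"
| "subtrees_at (Suc d) (Game l r) = subtrees_at d l @ subtrees_at d r"

(* A game is represented by the subtree rooted at it; rounds are numbered from 1. *)
definition games_of_round :: "bracket \<Rightarrow> nat \<Rightarrow> bracket list" where
  "games_of_round T s =
     (if 1 \<le> s \<and> s \<le> rounds T then filter is_Game (subtrees_at (rounds T - s) T) else [])"

definition signature :: "bracket \<Rightarrow> nat list" where
  "signature T = map (\<lambda>k. card {i \<in> teams T. byes T i = k}) [0..<Suc (rounds T)]"

primrec chalk_winner :: "bracket \<Rightarrow> nat" where
  "chalk_winner (Team i) = i"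
| "chalk_winner (Game l r) = min (chalk_winner l) (chalk_winner r)"

definition chalk_meet :: "bracket \<Rightarrow> nat \<Rightarrow> nat \<Rightarrow> nat \<Rightarrow> bool" where
  "chalk_meet T s i j \<longleftrightarrow>
     (\<exists>l r. Game l r \<in> set (games_of_round T s) \<and> {i, j} = {chalk_winner l, chalk_winner r})"

definition chalk_alive :: "bracket \<Rightarrow> nat \<Rightarrow> nat \<Rightarrow> bool" where
  "chalk_alive T s i \<longleftrightarrow> i \<in> teams T \<and> (\<forall>s'<s. \<forall>j. chalk_meet T s' i j \<longrightarrow> i < j)"

definition proper :: "bracket \<Rightarrow> bool" where
  "proper T \<longleftrightarrow> (\<forall>s\<in>{1..rounds T}. \<forall>i j.
     i < j \<and> chalk_alive T s i \<and> chalk_alive T s j \<longrightarrow>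
       (has_bye T s j \<longrightarrow> has_bye T s i) \<and>
       (\<forall>i' j'. chalk_meet T s i i' \<and> chalk_meet T s j j' \<longrightarrow> i' > j'))"

(* "The bracket A" for a signature A: the proper bracket with signature A, which is unique up to
   swapping children. *)
definition proper_bracket_of :: "nat list \<Rightarrow> bracket \<Rightarrow> bool" where
  "proper_bracket_of \<A> T \<longleftrightarrow> is_bracket T \<and> proper T \<and> signature T = \<A>"

(* In round s + 1 the winners of round s and the teams with exactly s byes are paired up;
   see sig_games_signature below. *)
primrec sig_games :: "nat list \<Rightarrow> nat \<Rightarrow> nat" where
  "sig_games \<A> 0 = 0"
| "sig_games \<A> (Suc s) = (sig_games \<A> s + (if s < length \<A> then \<A> ! s else 0)) div 2"

definition sig_rounds :: "nat list \<Rightarrow> nat" where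
  "sig_rounds \<A> = length \<A> - 1"

definition sig_contains :: "nat list \<Rightarrow> nat list \<Rightarrow> bool" where
  "sig_contains \<A> \<B> \<longleftrightarrow> (\<exists>i.
     sig_games \<A> (i + 1) \<ge> sig_games \<B> 1 \<and>
     (\<forall>j. 1 < j \<and> j \<le> sig_rounds \<B> \<longrightarrow> sig_games \<A> (i + j) = sig_games \<B> j))"

definition matchup_table :: "nat \<Rightarrow> (nat \<Rightarrow> nat \<Rightarrow> real) \<Rightarrow> bool" where
  "matchup_table n p \<longleftrightarrow>
     (\<forall>i\<in>{1..n}. \<forall>j\<in>{1..n}. 0 \<le> p i j \<and> p i j \<le> 1 \<and> p i j + p j i = 1)"

definition SST :: "nat \<Rightarrow> (nat \<Rightarrow> nat \<Rightarrow> real) \<Rightarrow> bool" where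
  "SST n p \<longleftrightarrow> (\<forall>i\<in>{1..n}. \<forall>j\<in>{1..n}. \<forall>k\<in>{1..n}. j < k \<longrightarrow> p i j \<le> p i k)"

(* A tournament format enters only through the distribution of its champion. *)
definition ordered_format :: "nat \<Rightarrow> ((nat \<Rightarrow> nat \<Rightarrow> real) \<Rightarrow> nat pmf) \<Rightarrow> bool" where
  "ordered_format n F \<longleftrightarrow> (\<forall>p. matchup_table n p \<and> SST n p \<longrightarrow>
     (\<forall>i\<in>{1..n}. \<forall>j\<in>{1..n}. i < j \<longrightarrow> pmf (F p) i \<ge> pmf (F p) j))"

primrec champion :: "(nat \<Rightarrow> nat \<Rightarrow> real) \<Rightarrow> bracket \<Rightarrow> nat pmf" where
  "champion p (Team i) = return_pmf i"
| "champion p (Game l r) =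
     bind_pmf (champion p l) (\<lambda>i.
     bind_pmf (champion p r) (\<lambda>j.
     bind_pmf (bernoulli_pmf (p i j)) (\<lambda>b.
     return_pmf (if b then i else j))))"

definition ordered :: "bracket \<Rightarrow> bool" where
  "ordered T \<longleftrightarrow> ordered_format (num_teams T) (\<lambda>p. champion p T)"

lemma teams_simps [simp]:
  "teams (Team i) = {i}" "teams (Game l r) = teams l \<union> teams r"
  by (auto simp: teams_def)

lemma subtrees_at_step:
  "length (subtrees_at (Suc d) T) = 2 * length (filter is_Game (subtrees_at d T))"
proof (induction d arbitrary: T)
  case 0
  show ?case by (cases T) auto
next
  case (Suc d)
  show ?case using Suc by (cases T) auto
qed

lemma subtrees_at_deep: "d > rounds T \<Longrightarrow> subtrees_at d T = []"
proof (induction T arbitrary: d)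
  case (Team i)
  then show ?case by (cases d) auto
next
  case (Game l r)
  then show ?case by (cases d) auto
qed

lemma leaf_depth_le: "i \<in> teams T \<Longrightarrow> leaf_depth T i \<le> rounds T"
  by (induction T) (auto simp: le_max_iff_disj)

lemma card_leaf_depth:
  "distinct (leaves T) \<Longrightarrow>
   card {i \<in> teams T. leaf_depth T i = d} = length (filter (\<lambda>S. \<not> is_Game S) (subtrees_at d T))"
proof (induction T arbitrary: d)
  case (Team i)
  have "{ia. ia = i \<and> 0 = d} = (if d = 0 then {i} else {})" by auto
  then show ?case by (cases d) auto
next
  case (Game l r)
  then have dis: "teams l \<inter> teams r = {}" by (auto simp: teams_def)
  show ?case
  proof (cases d)
    case 0
    then show ?thesis by simp
  next
    case (Suc e)
    have "{i \<in> teams (Game l r). leaf_depth (Game l r) i = d} =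
      {i \<in> teams l. leaf_depth l i = e} \<union> {i \<in> teams r. leaf_depth r i = e}"
      using dis Suc by auto
    moreover have "card ({i \<in> teams l. leaf_depth l i = e} \<union> {i \<in> teams r. leaf_depth r i = e}) =
      card {i \<in> teams l. leaf_depth l i = e} + card {i \<in> teams r. leaf_depth r i = e}"
      using dis by (intro card_Un_disjoint) (auto simp: teams_def)
    ultimately show ?thesis using Game Suc by simp
  qed
qed

lemma sig_games_signature:
  assumes "is_bracket T"
  shows "sig_games (signature T) s = length (games_of_round T s)"
proof (induction s)
  case 0
  show ?case by (simp add: games_of_round_def)
next
  case (Suc s)
  let ?R = "rounds T"
  have dist: "distinct (leaves T)" using assms by (simp add: is_bracket_def)
  have part: "length (subtrees_at d T) =
      length (filter is_Game (subtrees_at d T)) + length (filter (\<lambda>S. \<not> is_Game S) (subtrees_at d T))" for d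
    by (simp add: sum_length_filter_compl)
  have nth: "signature T ! s = length (filter (\<lambda>S. \<not> is_Game S) (subtrees_at (?R - s) T))" if "s \<le> ?R"
  proof -
    have "{i \<in> teams T. byes T i = s} = {i \<in> teams T. leaf_depth T i = ?R - s}"
      using that leaf_depth_le[of _ T] by (force simp: byes_def)
    moreover have "signature T ! s = card {i \<in> teams T. byes T i = s}"
      using that by (simp add: signature_def del: upt_Suc)
    ultimately show ?thesis using card_leaf_depth[OF dist] by simp
  qed
  have bottom: "length (filter is_Game (subtrees_at ?R T)) = 0"
    using subtrees_at_step[of ?R T] subtrees_at_deep[of T "Suc ?R"] by simp
  have games: "length (games_of_round T s) = length (filter is_Game (subtrees_at (?R - s) T))" if "s \<le> ?R"
    using that bottom by (cases s) (auto simp: games_of_round_def)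
  have len: "length (signature T) = Suc ?R" by (simp add: signature_def)
  consider "s < ?R" | "s = ?R" | "s > ?R" by linarith
  then show ?case
  proof cases
    case 1
    then have "?R - s = Suc (?R - Suc s)" by simp
    with 1 have "sig_games (signature T) s + signature T ! s =
        2 * length (filter is_Game (subtrees_at (?R - Suc s) T))"
      using Suc nth games part[of "?R - s"] subtrees_at_step[of "?R - Suc s" T] by simp
    with 1 len show ?thesis by (simp add: games_of_round_def)
  next
    case 2
    with Suc nth games part[of 0] have "sig_games (signature T) s + signature T ! s = 1" by simp
    with 2 len show ?thesis by (simp add: games_of_round_def)
  next
    case 3
    with Suc len show ?thesis by (simp add: games_of_round_def)
  qed
qed

end

theory Submission
  imports Defs
begin

text \<open>Going chalk, the teams alive after round s of a proper bracket are exactly the seeds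
  1, ..., N(s), and the opponents of round s have seeds adding up to 2 N(s) + 1. If A contains B with
  offset i and B has r \<ge> 2 rounds (otherwise B is ordered), then N(i + j) in A exceeds N(j) in B by a
  constant m for 1 \<le> j \<le> r, so the subtree at the only game of round i + r of A is a copy of B on the
  seeds m + 1, ..., m + n with extra games against lower seeds inserted. Now take a table p violating order in B, use it for these n teams, let
  them beat all lower seeds, mix the result with a small weight e of coin flips, and let each of the m
  top seeds beat every team outside the top m with probability 1 - e/2. Every team of the copy then has
  to win the same number of further games, each with probability e/2, while its probability of winning
  the copy tends to its probability of winning B as e tends to 0; so the violation persists in A
  for small e.\<close>

section \<open>Slices of a bracket\<close>

text \<open>The subtrees still in play when d rounds remain: those rooted at depth d, together with the
  leaves of smaller depth.\<close>

fun slice :: "nat \<Rightarrow> bracket \<Rightarrow> bracket list" where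
  "slice 0 T = [T]"
| "slice (Suc d) (Team i) = [Team i]"
| "slice (Suc d) (Game l r) = slice d l @ slice d r"

lemma slice_Team [simp]: "slice d (Team i) = [Team i]"
  by (cases d) auto

lemma concat_leaves_slice: "concat (map leaves (slice d T)) = leaves T"
  by (induction d T rule: slice.induct) auto

lemma chalk_winner_in_teams: "chalk_winner T \<in> teams T"
  by (induction T) (auto simp: min_def)

lemma chalk_winner_le: "i \<in> teams T \<Longrightarrow> chalk_winner T \<le> i"
  by (induction T) (auto simp: min_le_iff_disj)

lemma finite_teams [simp]: "finite (teams T)"
  by (simp add: teams_def)

lemma teams_slice: "teams T = (\<Union>U\<in>set (slice d T). teams U)"
  using arg_cong[OF concat_leaves_slice[of d T], of set] by (simp add: teams_def)

lemma distinct_leaves_Game: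
  "distinct (leaves (Game l r)) \<longleftrightarrow> distinct (leaves l) \<and> distinct (leaves r) \<and> teams l \<inter> teams r = {}"
  by (simp add: teams_def)

lemma slice_distinct: "distinct (leaves T) \<Longrightarrow> U \<in> set (slice d T) \<Longrightarrow> distinct (leaves U)"
  by (induction d T rule: slice.induct) auto

text \<open>The halves of a game share no team, so the subtrees of a slice are disjoint. Later
  proofs identify a subtree from a single team in it, usually its chalk winner.\<close>

lemma slice_unique:
  assumes "distinct (leaves T)" "U \<in> set (slice d T)" "V \<in> set (slice d T)"
    and "x \<in> teams U" "x \<in> teams V"
  shows "U = V"
  using assms
proof (induction d T rule: slice.induct)
  case (3 d l r)
  have "teams l \<inter> teams r = {}" using 3(3) by (auto simp: teams_def)
  moreover have "teams W \<subseteq> teams l" if "W \<in> set (slice d l)" for W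
    using that teams_slice[of l d] by auto
  moreover have "teams W \<subseteq> teams r" if "W \<in> set (slice d r)" for W
    using that teams_slice[of r d] by auto
  ultimately show ?case using 3 by (simp add: distinct_leaves_Game) blast
qed auto

lemma distinct_chalk_winner_slice:
  "distinct (leaves T) \<Longrightarrow> distinct (map chalk_winner (slice d T))"
proof (induction d T rule: slice.induct)
  case (3 d l r)
  have "chalk_winner ` set (slice d l) \<subseteq> teams l" "chalk_winner ` set (slice d r) \<subseteq> teams r"
    using chalk_winner_in_teams teams_slice[of l d] teams_slice[of r d] by auto
  moreover have "teams l \<inter> teams r = {}" using 3(3) by (auto simp: teams_def)
  ultimately show ?case using 3 by (simp add: image_Un[symmetric]) blast
qed auto

lemma slice_Suc_iff:
  "U \<in> set (slice (Suc d) T) \<longleftrightarrow>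
    U \<in> set (slice d T) \<and> \<not> is_Game U \<or>
    (\<exists>l r. Game l r \<in> set (slice d T) \<and> (U = l \<or> U = r))"
proof (induction d arbitrary: T)
  case 0
  show ?case by (cases T) auto
next
  case (Suc d)
  show ?case
  proof (cases T)
    case (Game l r)
    show ?thesis unfolding Game slice.simps(3) set_append Un_iff Suc[of l] Suc[of r] by blast
  qed auto
qed

text \<open>Each game at depth \<open>d\<close> gives way to its two children, a net gain of one,
  while leaves stay. Read towards the root, a round removes one team per game.\<close>

lemma length_slice_Suc:
  "length (slice (Suc d) T) = length (slice d T) + length (filter is_Game (subtrees_at d T))"
proof (induction d arbitrary: T)
  case 0
  show ?case by (cases T) auto
next
  case (Suc d)
  show ?case using Suc by (cases T) auto
qed

lemma Game_in_subtrees_at: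
  "Game l r \<in> set (subtrees_at d T) \<longleftrightarrow> Game l r \<in> set (slice d T)"
  by (induction d T rule: slice.induct) auto

text \<open>This translates having a bye in a round into the presence of a leaf in a slice.\<close>

lemma Team_in_slice:
  "distinct (leaves T) \<Longrightarrow> Team i \<in> set (slice d T) \<longleftrightarrow> i \<in> teams T \<and> leaf_depth T i \<le> d"
proof (induction d T rule: slice.induct)
  case (1 T)
  show ?case by (cases T) auto
next
  case (3 d l r)
  have "Team i \<notin> set (slice d U)" if "i \<notin> teams U" for U
    using that teams_slice[of U d] by force
  moreover have "i \<notin> teams l \<or> i \<notin> teams r" "distinct (leaves l)" "distinct (leaves r)"
    using 3(3) unfolding distinct_leaves_Game by blast+
  ultimately show ?case using 3(1,2) by auto
qed auto

lemma slice_deep: "rounds T \<le> d \<Longrightarrow> set (slice d T) = Team ` teams T"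
proof (induction d T rule: slice.induct)
  case (1 T)
  then show ?case by (cases T) auto
qed auto

section \<open>Teams alive when the bracket goes chalk\<close>

text \<open>The index counts the rounds already played, whereas \<open>chalk_alive\<close> counts
  the round about to be played; hence the shift in \<open>chalk_alive_iff\<close>.\<close>

definition alive :: "bracket \<Rightarrow> nat \<Rightarrow> nat set" where
  "alive T s = chalk_winner ` set (slice (rounds T - s) T)"

definition num_alive :: "bracket \<Rightarrow> nat \<Rightarrow> nat" where
  "num_alive T s = length (slice (rounds T - s) T)"

lemma card_alive: "distinct (leaves T) \<Longrightarrow> card (alive T s) = num_alive T s"
  using distinct_card[OF distinct_chalk_winner_slice[of T "rounds T - s"]]
  by (simp add: alive_def num_alive_def)

lemma num_alive_rounds: "num_alive T (rounds T) = 1"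
  by (simp add: num_alive_def)

lemma num_alive_step:
  "s < rounds T \<Longrightarrow> num_alive T s = num_alive T (Suc s) + length (games_of_round T (Suc s))"
  using length_slice_Suc[of "rounds T - Suc s" T]
  by (simp add: num_alive_def games_of_round_def Suc_diff_Suc)

lemma alive_0: "alive T 0 = teams T"
  by (simp add: alive_def slice_deep image_image)

lemma chalk_meet_iff:
  "s < rounds T \<Longrightarrow> chalk_meet T (Suc s) i j \<longleftrightarrow>
    (\<exists>l r. Game l r \<in> set (slice (rounds T - Suc s) T) \<and> {i, j} = {chalk_winner l, chalk_winner r})"
  by (simp add: chalk_meet_def games_of_round_def Game_in_subtrees_at)

text \<open>The chalk winner of a game is the smaller of the chalk winners of its children, so the
  only teams to drop out are those that meet a smaller number.\<close>

lemma alive_Suc: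
  assumes dist: "distinct (leaves T)" and s: "s < rounds T"
  shows "alive T (Suc s) = {i \<in> alive T s. \<forall>j. chalk_meet T (Suc s) i j \<longrightarrow> i < j}"
proof -
  define d where "d = rounds T - Suc s"
  have Sd: "rounds T - s = Suc d" using s by (simp add: d_def)
  note meet = chalk_meet_iff[OF s, folded d_def]
  show ?thesis
  proof (intro set_eqI iffI)
    fix i assume "i \<in> alive T (Suc s)"
    then obtain U where U: "U \<in> set (slice d T)" "i = chalk_winner U"
      by (auto simp: alive_def d_def)
    have lt: "i < j" if "chalk_meet T (Suc s) i j" for j
    proof -
      from that obtain l r where lr: "Game l r \<in> set (slice d T)"
        "{i, j} = {chalk_winner l, chalk_winner r}" unfolding meet by blast
      have "i \<in> teams (Game l r)" using lr(2) chalk_winner_in_teams[of l] chalk_winner_in_teams[of r]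
        by (auto simp: doubleton_eq_iff)
      then have "U = Game l r"
        using slice_unique[OF dist U(1) lr(1), of i] U(2) chalk_winner_in_teams[of U] by simp
      moreover have "chalk_winner l \<noteq> chalk_winner r"
        using slice_distinct[OF dist lr(1)] chalk_winner_in_teams[of l] chalk_winner_in_teams[of r]
        unfolding distinct_leaves_Game by auto
      ultimately show ?thesis using lr(2) U(2) by (auto simp: doubleton_eq_iff min_def split: if_splits)
    qed
    have "i \<in> alive T s"
    proof (cases U)
      case (Team k)
      then have "U \<in> set (slice (Suc d) T)" using U unfolding slice_Suc_iff by simp
      then show ?thesis unfolding alive_def Sd using U by blast
    next
      case (Game l r)
      then have "l \<in> set (slice (Suc d) T)" "r \<in> set (slice (Suc d) T)"
        using U unfolding slice_Suc_iff by blast+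
      moreover have "i = chalk_winner l \<or> i = chalk_winner r" using U Game by (simp add: min_def)
      ultimately show ?thesis unfolding alive_def Sd by blast
    qed
    with lt show "i \<in> {i \<in> alive T s. \<forall>j. chalk_meet T (Suc s) i j \<longrightarrow> i < j}" by blast
  next
    fix i assume "i \<in> {i \<in> alive T s. \<forall>j. chalk_meet T (Suc s) i j \<longrightarrow> i < j}"
    then have win: "\<And>j. chalk_meet T (Suc s) i j \<Longrightarrow> i < j" and "i \<in> alive T s" by auto
    then obtain U where U: "U \<in> set (slice (Suc d) T)" "i = chalk_winner U"
      by (auto simp: alive_def Sd)
    have "\<exists>V \<in> set (slice d T). i = chalk_winner V"
    proof (cases "U \<in> set (slice d T) \<and> \<not> is_Game U")
      case True
      then show ?thesis using U by blast
    next
      case False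
      then obtain l r where lr: "Game l r \<in> set (slice d T)" "U = l \<or> U = r"
        using U(1) unfolding slice_Suc_iff by blast
      then have "chalk_meet T (Suc s) i (if U = l then chalk_winner r else chalk_winner l)"
        using U(2) unfolding meet by (auto simp: doubleton_eq_iff)
      from win[OF this] have "i = chalk_winner (Game l r)" using lr(2) U(2) by (auto split: if_splits)
      with lr(1) show ?thesis by blast
    qed
    then show "i \<in> alive T (Suc s)" by (auto simp: alive_def d_def)
  qed
qed

lemma chalk_alive_iff:
  "distinct (leaves T) \<Longrightarrow> s \<le> rounds T \<Longrightarrow> chalk_alive T (Suc s) i \<longleftrightarrow> i \<in> alive T s"
proof (induction s)
  case 0
  show ?case by (simp add: alive_0 chalk_alive_def chalk_meet_def games_of_round_def)
next
  case (Suc s)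
  have "chalk_alive T (Suc (Suc s)) i \<longleftrightarrow>
    chalk_alive T (Suc s) i \<and> (\<forall>j. chalk_meet T (Suc s) i j \<longrightarrow> i < j)"
    by (auto simp: chalk_alive_def less_Suc_eq)
  then show ?case using Suc alive_Suc[of T s] by simp
qed

section \<open>A round of a proper bracket\<close>

text \<open>A strictly decreasing map on integers drops by at least one per step. Starting from the
  left end this gives the upper bound, from the right end the lower one, so the map is the
  reflection of the interval.\<close>

lemma antitone_self_map_interval:
  fixes f :: "nat \<Rightarrow> nat"
  assumes maps: "\<And>x. a < x \<Longrightarrow> x \<le> b \<Longrightarrow> a < f x \<and> f x \<le> b"
    and anti: "\<And>x y. a < x \<Longrightarrow> x < y \<Longrightarrow> y \<le> b \<Longrightarrow> f y < f x"
    and x: "a < x" "x \<le> b"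
  shows "f x + x = a + b + 1"
proof (rule antisym)
  have "Suc a \<le> x" using x by simp
  then show "f x + x \<le> a + b + 1" using x(2)
  proof (induction x rule: dec_induct)
    case base
    then show ?case using maps[of "Suc a"] by simp
  next
    case (step k)
    then show ?case using anti[of k "Suc k"] by simp
  qed
  show "a + b + 1 \<le> f x + x" using x(2,1)
  proof (induction x rule: inc_induct)
    case base
    then show ?case using maps[of b] by simp
  next
    case (step k)
    then show ?case using anti[of k "Suc k"] by simp
  qed
qed

text \<open>Properness gives the byes to an initial segment \<open>{1..a}\<close> of the teams alive
  and makes the opponent map strictly decreasing on the rest. That map is therefore a reflection,
  and the survivors are the teams with byes and the better half of the others.\<close>

lemma proper_round:
  assumes dist: "distinct (leaves T)" and proper: "proper T" and s: "s < rounds T"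
    and alive: "alive T s = {1..N}"
  defines "F \<equiv> set (slice (rounds T - Suc s) T)"
  obtains a where "a \<le> N" "even (a + N)" "alive T (Suc s) = {1..(a + N) div 2}"
    "\<And>l r. Game l r \<in> F \<Longrightarrow> chalk_winner l + chalk_winner r = a + N + 1"
    "\<And>l r. Game l r \<in> F \<Longrightarrow> a < chalk_winner (Game l r)"
    "\<And>i. Team i \<in> F \<Longrightarrow> i \<le> a"
proof -
  define d where "d = rounds T - Suc s"
  have F: "F = set (slice d T)" by (simp add: F_def d_def)
  have Sd: "rounds T - s = Suc d" using s by (simp add: d_def)
  note meet = chalk_meet_iff[OF s, folded d_def, folded F]
  have bye: "has_bye T (Suc s) i \<longleftrightarrow> Team i \<in> F" if "i \<in> teams T" for i
    using that s Team_in_slice[OF dist, of i d] leaf_depth_le[OF that]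
    by (auto simp: has_bye_def byes_def F d_def)
  have aliveD: "1 \<le> i \<and> i \<le> N \<and> i \<in> teams T" if "U \<in> set (slice (Suc d) T)" "i = chalk_winner U" for U i
    using that alive chalk_winner_in_teams[of U] teams_slice[of T "Suc d"]
    unfolding alive_def Sd by fastforce
  have inT: "i \<in> teams T" if "1 \<le> i" "i \<le> N" for i
  proof -
    have "i \<in> alive T s" using that alive by simp
    then show ?thesis using aliveD unfolding alive_def Sd by blast
  qed
  have key: "(has_bye T (Suc s) j \<longrightarrow> has_bye T (Suc s) i) \<and>
       (\<forall>i' j'. chalk_meet T (Suc s) i i' \<and> chalk_meet T (Suc s) j j' \<longrightarrow> i' > j')"
    if "1 \<le> i" "i < j" "j \<le> N" for i j
  proof -
    have "i \<in> alive T s" "j \<in> alive T s" using that alive by auto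
    then have "chalk_alive T (Suc s) i" "chalk_alive T (Suc s) j"
      using chalk_alive_iff[OF dist] s by simp_all
    moreover have "Suc s \<in> {1..rounds T}" using s by simp
    ultimately show ?thesis using proper that(2) unfolding proper_def by blast
  qed
  have TeamF: "1 \<le> i \<and> i \<le> N" if "Team i \<in> F" for i
    using aliveD[of "Team i" i] that unfolding F slice_Suc_iff by simp
  \<comment> \<open>Inserting 0 covers a round without byes.\<close>
  define a where "a = Max (insert 0 {i. Team i \<in> F})"
  have fin: "finite (insert 0 {i. Team i \<in> F})"
    by (rule finite_subset[of _ "{0..N}"]) (use TeamF in auto)
  have a_in: "a \<in> insert 0 {i. Team i \<in> F}" unfolding a_def by (rule Max_in[OF fin]) simp
  then have aN: "a \<le> N" using TeamF by auto
  have Team_le: "i \<le> a" if "Team i \<in> F" for i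
    unfolding a_def by (rule Max_ge[OF fin]) (use that in simp)
  have le_Team: "Team i \<in> F" if "1 \<le> i" "i \<le> a" for i
  proof (cases "i = a")
    case True
    then show ?thesis using a_in that by auto
  next
    case False
    then have "Team a \<in> F" "i < a" using a_in that by auto
    then show ?thesis using key[of i a] bye inT aN that by simp
  qed
  \<comment> \<open>Seeds up to \<open>a\<close> occupy leaves of the slice, so they cannot occur
    below a game.\<close>
  have GameF: "a < chalk_winner l \<and> chalk_winner l \<le> N \<and> a < chalk_winner r \<and> chalk_winner r \<le> N
     \<and> chalk_winner l \<noteq> chalk_winner r"
    if lr: "Game l r \<in> F" for l r
  proof -
    have noTeam: "Team x \<notin> F" if "x \<in> teams (Game l r)" for x
    proof
      assume "Team x \<in> F"
      with slice_unique[OF dist, of "Team x" d "Game l r" x] lr that show False unfolding F by auto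
    qed
    have "a < chalk_winner U \<and> chalk_winner U \<le> N" if "U = l \<or> U = r" for U
    proof -
      have "U \<in> set (slice (Suc d) T)" using that lr unfolding slice_Suc_iff F by blast
      then have "1 \<le> chalk_winner U \<and> chalk_winner U \<le> N" using aliveD by blast
      moreover have "Team (chalk_winner U) \<notin> F"
        using noTeam that chalk_winner_in_teams[of U] by auto
      ultimately show ?thesis using le_Team[of "chalk_winner U"] by force
    qed
    moreover have "chalk_winner l \<noteq> chalk_winner r"
      using slice_distinct[OF dist lr[unfolded F]] chalk_winner_in_teams[of l]
        chalk_winner_in_teams[of r] unfolding distinct_leaves_Game by auto
    ultimately show ?thesis by blast
  qed
  have meetD: "a < x \<and> x \<le> N \<and> a < y \<and> y \<le> N \<and> x \<noteq> y" if "chalk_meet T (Suc s) x y" for x y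
    using that GameF unfolding meet doubleton_eq_iff by metis
  have ex_meet: "\<exists>y. chalk_meet T (Suc s) x y" if x: "a < x" "x \<le> N" for x
  proof -
    have "x \<in> alive T s" using that alive by simp
    then obtain U where U: "U \<in> set (slice (Suc d) T)" "x = chalk_winner U"
      by (auto simp: alive_def Sd)
    have "\<not> (U \<in> F \<and> \<not> is_Game U)"
      using Team_le[of x] x U(2) by (cases U) auto
    then obtain l r where "Game l r \<in> F" "U = l \<or> U = r"
      using U(1) unfolding slice_Suc_iff F by blast
    then show ?thesis using U(2) unfolding meet by (metis insert_commute)
  qed
  \<comment> \<open>\<open>f\<close> is the opponent map; \<open>uniq\<close> below shows that the
    choice is forced.\<close>
  define f where "f x = (SOME y. chalk_meet T (Suc s) x y)" for x
  have f: "chalk_meet T (Suc s) x (f x)" if "a < x" "x \<le> N" for x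
    unfolding f_def using ex_meet[OF that] by (rule someI_ex)
  have uniq: "y = z" if "chalk_meet T (Suc s) x y" "chalk_meet T (Suc s) x z" for x y z
  proof -
    obtain l r l' r' where lr: "Game l r \<in> F" "{x, y} = {chalk_winner l, chalk_winner r}"
      and lr': "Game l' r' \<in> F" "{x, z} = {chalk_winner l', chalk_winner r'}"
      using \<open>chalk_meet T (Suc s) x y\<close> \<open>chalk_meet T (Suc s) x z\<close> unfolding meet by blast
    have "x \<in> teams (Game l r)" using lr(2) chalk_winner_in_teams[of l] chalk_winner_in_teams[of r]
      by (auto simp: doubleton_eq_iff)
    moreover have "x \<in> teams (Game l' r')"
      using lr'(2) chalk_winner_in_teams[of l'] chalk_winner_in_teams[of r']
      by (auto simp: doubleton_eq_iff)
    ultimately have "Game l r = Game l' r'"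
      using slice_unique[OF dist, of "Game l r" d "Game l' r'" x] lr(1) lr'(1) unfolding F by blast
    then show ?thesis using lr(2) lr'(2) by (auto simp: doubleton_eq_iff)
  qed
  have fsum: "f x + x = a + N + 1" if "a < x" "x \<le> N" for x
  proof (rule antitone_self_map_interval[OF _ _ that])
    fix x assume "a < x" "x \<le> N"
    then show "a < f x \<and> f x \<le> N" using f meetD by blast
  next
    fix x y assume "a < x" "x < y" "y \<le> N"
    then show "f y < f x" using key[of x y] f[of x] f[of y] by auto
  qed
  have meet_sum: "x + y = a + N + 1" if "chalk_meet T (Suc s) x y" for x y
  proof -
    have x: "a < x" "x \<le> N" using meetD that by blast+
    then have "y = f x" using uniq that f by blast
    then show ?thesis using fsum[OF x] by simp
  qed
  have Game_sum: "chalk_winner l + chalk_winner r = a + N + 1" if "Game l r \<in> F" for l r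
    by (rule meet_sum) (use that in \<open>auto simp: meet\<close>)
  \<comment> \<open>Were \<open>a + N\<close> odd, the reflection would fix the middle seed, which
    would then play itself.\<close>
  have ev: "even (a + N)"
  proof (rule ccontr)
    assume odd: "odd (a + N)"
    define x where "x = (a + N + 1) div 2"
    have "2 * x = a + N + 1" using odd by (simp add: x_def)
    moreover have "a \<noteq> N" using odd by auto
    ultimately have "a < x" "x \<le> N" "2 * x = a + N + 1" using aN by linarith+
    then show False using meetD[OF f[of x]] fsum[of x] by simp
  qed
  have "alive T (Suc s) = {1..(a + N) div 2}"
  proof -
    have "i \<in> alive T (Suc s) \<longleftrightarrow> 1 \<le> i \<and> i \<le> (a + N) div 2" for i
    proof (cases "a < i \<and> i \<le> N")
      case True
      have "i \<in> alive T (Suc s) \<longleftrightarrow> i < f i"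
      proof -
        have "chalk_meet T (Suc s) i j \<longleftrightarrow> j = f i" for j
          using True f[of i] uniq by blast
        moreover have "i \<in> {1..N}" using True by simp
        ultimately show ?thesis unfolding alive_Suc[OF dist s] alive by simp
      qed
      also have "\<dots> \<longleftrightarrow> i \<le> (a + N) div 2"
      proof -
        obtain h where h: "a + N = 2 * h" using ev by (rule evenE)
        then have "f i + i = 2 * h + 1" using fsum[of i] True by simp
        then show ?thesis unfolding h by auto
      qed
      finally show ?thesis using True by auto
    next
      case False
      \<comment> \<open>Seeds up to \<open>a\<close> meet nobody in this round, so they all survive
        it.\<close>
      then have "i \<in> alive T (Suc s) \<longleftrightarrow> 1 \<le> i \<and> i \<le> N"
        unfolding alive_Suc[OF dist s] alive using meetD by fastforce
      moreover have "a \<le> (a + N) div 2" "(a + N) div 2 \<le> N" using aN by linarith+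
      ultimately show ?thesis using False aN by linarith
    qed
    then show ?thesis by (intro set_eqI) (simp only: atLeastAtMost_iff)
  qed
  moreover have "a < chalk_winner (Game l r)" if "Game l r \<in> F" for l r
    using GameF[OF that] by simp
  ultimately show ?thesis using that[of a] aN ev Game_sum Team_le by blast
qed

lemma alive_proper:
  assumes "is_bracket T" "proper T"
  shows "s \<le> rounds T \<Longrightarrow> alive T s = {1..num_alive T s}"
proof (induction s)
  case 0
  then show ?case using assms card_alive[of T 0] by (simp add: alive_0 is_bracket_def)
next
  case (Suc s)
  have dist: "distinct (leaves T)" using assms by (simp add: is_bracket_def)
  have "s < rounds T" "alive T s = {1..num_alive T s}" using Suc by auto
  from proper_round[OF dist assms(2) this] obtain c where "alive T (Suc s) = {1..c}"
    by metis
  then show ?case using card_alive[OF dist, of "Suc s"] by simp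
qed

text \<open>Since N(s + 1) is half of a + N(s), the bound a on the seeds with byes is 2 N(s + 1) -
  N(s), written here without subtraction. The pairing in a round thus depends on the counts alone,
  which makes two brackets comparable.\<close>

lemma proper_round_facts:
  assumes "is_bracket T" "proper T" and s: "s < rounds T"
  defines "F \<equiv> set (slice (rounds T - Suc s) T)"
  shows "Game l r \<in> F \<Longrightarrow> chalk_winner l + chalk_winner r = 2 * num_alive T (Suc s) + 1"
    and "Game l r \<in> F \<Longrightarrow> 2 * num_alive T (Suc s) < num_alive T s + chalk_winner (Game l r)"
    and "Team i \<in> F \<Longrightarrow> num_alive T s + i \<le> 2 * num_alive T (Suc s)"
proof -
  have dist: "distinct (leaves T)" using assms by (simp add: is_bracket_def)
  have al: "alive T s = {1..num_alive T s}" using alive_proper[OF assms(1,2)] s by simp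
  obtain a where a: "a \<le> num_alive T s" "even (a + num_alive T s)"
    "alive T (Suc s) = {1..(a + num_alive T s) div 2}"
    "\<And>l r. Game l r \<in> F \<Longrightarrow> chalk_winner l + chalk_winner r = a + num_alive T s + 1"
    "\<And>l r. Game l r \<in> F \<Longrightarrow> a < chalk_winner (Game l r)"
    "\<And>i. Team i \<in> F \<Longrightarrow> i \<le> a"
    using proper_round[OF dist assms(2) s al] unfolding F_def by metis
  have "num_alive T (Suc s) = (a + num_alive T s) div 2"
    using card_alive[OF dist, of "Suc s"] a(3) by simp
  then have eq: "2 * num_alive T (Suc s) = a + num_alive T s" using a(2) by simp
  show "Game l r \<in> F \<Longrightarrow> chalk_winner l + chalk_winner r = 2 * num_alive T (Suc s) + 1"
    using a(4) eq by simp
  show "Game l r \<in> F \<Longrightarrow> 2 * num_alive T (Suc s) < num_alive T s + chalk_winner (Game l r)"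
    using a(5)[of l r] eq by linarith
  show "Team i \<in> F \<Longrightarrow> num_alive T s + i \<le> 2 * num_alive T (Suc s)"
    using a(6) eq by simp
qed

section \<open>Distribution of the champion\<close>

lemma set_pmf_champion: "set_pmf (champion p T) \<subseteq> teams T"
  by (induction T) (auto split: if_splits)

lemma bernoulli_pmf_flip:
  assumes "0 \<le> x" "x \<le> 1"
  shows "bernoulli_pmf (1 - x) = map_pmf Not (bernoulli_pmf x)"
proof (rule pmf_eqI)
  fix b
  have "pmf (map_pmf Not (bernoulli_pmf x)) (Not (\<not> b)) = pmf (bernoulli_pmf x) (\<not> b)"
    by (rule pmf_map_inj') (auto simp: inj_def)
  then show "pmf (bernoulli_pmf (1 - x)) b = pmf (map_pmf Not (bernoulli_pmf x)) b"
    using assms by (cases b) auto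
qed

text \<open>The two winners are independent and can be sampled in either order, and
  \<open>p i j + p j i = 1\<close> makes the game itself symmetric. Later case splits can then treat
  one orientation.\<close>

lemma champion_commute:
  assumes "\<And>i j. i \<in> teams l \<Longrightarrow> j \<in> teams r \<Longrightarrow> 0 \<le> p i j \<and> p i j \<le> 1 \<and> p i j + p j i = 1"
  shows "champion p (Game l r) = champion p (Game r l)"
proof -
  have game: "bind_pmf (bernoulli_pmf (p i j)) (\<lambda>b. return_pmf (if b then i else j)) =
      bind_pmf (bernoulli_pmf (p j i)) (\<lambda>b. return_pmf (if b then j else i))"
    if "i \<in> set_pmf (champion p l)" "j \<in> set_pmf (champion p r)" for i j
  proof -
    have p: "0 \<le> p i j" "p i j \<le> 1" "p i j + p j i = 1"
      using assms[of i j] that set_pmf_champion by blast+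
    then have "p j i = 1 - p i j" by simp
    then have "bernoulli_pmf (p j i) = map_pmf Not (bernoulli_pmf (p i j))"
      using bernoulli_pmf_flip[OF p(1,2)] by simp
    then show ?thesis by (simp add: bind_map_pmf) (rule bind_pmf_cong; simp)
  qed
  have "champion p (Game l r) = bind_pmf (champion p l) (\<lambda>i. bind_pmf (champion p r) (\<lambda>j.
      bind_pmf (bernoulli_pmf (p j i)) (\<lambda>b. return_pmf (if b then j else i))))"
    unfolding champion.simps by (intro bind_pmf_cong refl game)
  then show ?thesis by (subst (asm) bind_commute_pmf) simp
qed

text \<open>A game against sure losers acts like a bye. The extra games that the larger bracket
  inserts into the copy are of this kind.\<close>

lemma champion_bye:
  assumes "champion p l = return_pmf c" "\<And>x. x \<in> teams r \<Longrightarrow> p c x = 1"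
  shows "champion p (Game l r) = return_pmf c"
proof -
  have sure: "bernoulli_pmf 1 = return_pmf True"
  proof (rule pmf_eqI)
    show "pmf (bernoulli_pmf 1) b = pmf (return_pmf True) b" for b by (cases b) simp_all
  qed
  have "champion p (Game l r) = bind_pmf (champion p r)
      (\<lambda>j. bind_pmf (bernoulli_pmf (p c j)) (\<lambda>b. return_pmf (if b then c else j)))"
    using assms(1) by (simp add: bind_return_pmf)
  also have "\<dots> = bind_pmf (champion p r) (\<lambda>j. return_pmf c)"
  proof (rule bind_pmf_cong[OF refl])
    fix j assume "j \<in> set_pmf (champion p r)"
    then have "p c j = 1" using assms(2) set_pmf_champion by blast
    then show "bind_pmf (bernoulli_pmf (p c j)) (\<lambda>b. return_pmf (if b then c else j)) = return_pmf c"
      by (simp add: sure bind_return_pmf)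
  qed
  finally show ?thesis by simp
qed

lemma champion_dominant:
  assumes "distinct (leaves U)" "c \<in> teams U"
    and "\<And>x. x \<in> teams U \<Longrightarrow> x \<noteq> c \<Longrightarrow> p c x = 1"
    and "\<And>i j. i \<in> teams U \<Longrightarrow> j \<in> teams U \<Longrightarrow> 0 \<le> p i j \<and> p i j \<le> 1 \<and> p i j + p j i = 1"
  shows "champion p U = return_pmf c"
  using assms
proof (induction U)
  case (Game l r)
  have dis: "teams l \<inter> teams r = {}" "distinct (leaves l)" "distinct (leaves r)"
    using Game.prems(1) unfolding distinct_leaves_Game by blast+
  show ?case
  proof (cases "c \<in> teams l")
    case True
    then have "champion p l = return_pmf c" using Game dis by auto
    then show ?thesis using True dis Game.prems(3) by (intro champion_bye) auto
  next
    case False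
    then have c: "c \<in> teams r" using Game.prems(2) by simp
    then have "champion p r = return_pmf c" using Game dis by auto
    then have "champion p (Game r l) = return_pmf c"
      using False Game.prems(3) by (intro champion_bye) auto
    moreover have "champion p (Game l r) = champion p (Game r l)"
      using Game.prems(4) by (intro champion_commute) simp
    ultimately show ?thesis by simp
  qed
qed auto

text \<open>Only one level is relabelled: the brackets compared later differ in shape, so that
  induction runs over rounds instead of over one tree.\<close>

lemma champion_map_Game:
  assumes "champion q l = map_pmf f (champion p l')" "champion q r = map_pmf f (champion p r')"
    and "\<And>a b. a \<in> teams l' \<Longrightarrow> b \<in> teams r' \<Longrightarrow> q (f a) (f b) = p a b"
  shows "champion q (Game l r) = map_pmf f (champion p (Game l' r'))"
proof -
  have "champion q (Game l r) = bind_pmf (champion p l') (\<lambda>a. bind_pmf (champion p r') (\<lambda>b.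
      bind_pmf (bernoulli_pmf (q (f a) (f b))) (\<lambda>w. return_pmf (if w then f a else f b))))"
    using assms(1,2) by (simp add: bind_map_pmf)
  also have "\<dots> = bind_pmf (champion p l') (\<lambda>a. bind_pmf (champion p r') (\<lambda>b.
      bind_pmf (bernoulli_pmf (p a b)) (\<lambda>w. return_pmf (f (if w then a else b)))))"
    using assms(3) subsetD[OF set_pmf_champion]
    by (intro bind_pmf_cong refl arg_cong[of _ _ bernoulli_pmf]) (simp_all add: if_distrib)
  also have "\<dots> = map_pmf f (champion p (Game l' r'))"
    by (simp add: map_bind_pmf)
  finally show ?thesis .
qed

text \<open>Unfolded repeatedly, this shows that winning probabilities are polynomials in the
  entries of the table.\<close>

lemma pmf_champion_Game:
  assumes "\<And>i j. i \<in> teams l \<Longrightarrow> j \<in> teams r \<Longrightarrow> 0 \<le> p i j \<and> p i j \<le> 1"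
  shows "pmf (champion p (Game l r)) k =
    (\<Sum>i\<in>teams l. \<Sum>j\<in>teams r. pmf (champion p l) i * pmf (champion p r) j *
      ((if k = i then p i j else 0) + (if k = j then 1 - p i j else 0)))"
proof -
  have game: "pmf (bind_pmf (bernoulli_pmf (p i j)) (\<lambda>b. return_pmf (if b then i else j))) k =
      (if k = i then p i j else 0) + (if k = j then 1 - p i j else 0)"
    if "i \<in> teams l" "j \<in> teams r" for i j
    using assms[OF that] by (auto simp: pmf_bind)
  have int: "measure_pmf.expectation (champion p T) f = (\<Sum>i\<in>teams T. pmf (champion p T) i * f i)"
    for T and f :: "nat \<Rightarrow> real"
    by (subst integral_measure_pmf[of "teams T"]) (use subsetD[OF set_pmf_champion] in auto)
  have "pmf (champion p (Game l r)) k = (\<Sum>i\<in>teams l. pmf (champion p l) i *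
      (\<Sum>j\<in>teams r. pmf (champion p r) j *
        pmf (bind_pmf (bernoulli_pmf (p i j)) (\<lambda>b. return_pmf (if b then i else j))) k))"
    by (simp add: pmf_bind[of "champion p l"] pmf_bind[of "champion p r"] int)
  also have "\<dots> = (\<Sum>i\<in>teams l. pmf (champion p l) i * (\<Sum>j\<in>teams r. pmf (champion p r) j *
        ((if k = i then p i j else 0) + (if k = j then 1 - p i j else 0))))"
    by (intro sum.cong refl arg_cong2[of _ _ _ _ "(*)"] game)
  finally show ?thesis by (simp add: sum_distrib_left mult.assoc)
qed

lemma tendsto_pmf_champion:
  assumes "\<And>i j. i \<in> teams T \<Longrightarrow> j \<in> teams T \<Longrightarrow> ((\<lambda>x. q x i j) \<longlongrightarrow> q' i j) F"
    and "\<And>x i j. i \<in> teams T \<Longrightarrow> j \<in> teams T \<Longrightarrow> 0 \<le> q x i j \<and> q x i j \<le> 1"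
    and "\<And>i j. i \<in> teams T \<Longrightarrow> j \<in> teams T \<Longrightarrow> 0 \<le> q' i j \<and> q' i j \<le> 1"
  shows "((\<lambda>x. pmf (champion (q x) T) k) \<longlongrightarrow> pmf (champion q' T) k) F"
  using assms
proof (induction T arbitrary: k)
  case (Game l r)
  have 1: "pmf (champion (q x) (Game l r)) k =
    (\<Sum>i\<in>teams l. \<Sum>j\<in>teams r. pmf (champion (q x) l) i * pmf (champion (q x) r) j *
      ((if k = i then q x i j else 0) + (if k = j then 1 - q x i j else 0)))" for x
    using Game.prems(2) by (intro pmf_champion_Game) simp
  have 2: "pmf (champion q' (Game l r)) k =
    (\<Sum>i\<in>teams l. \<Sum>j\<in>teams r. pmf (champion q' l) i * pmf (champion q' r) j *
      ((if k = i then q' i j else 0) + (if k = j then 1 - q' i j else 0)))"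
    using Game.prems(3) by (intro pmf_champion_Game) simp
  \<comment> \<open>The conditions do not involve the limit variable, so a conditional converges
    branch by branch.\<close>
  have if_lim: "((\<lambda>x. if P then f x else 0) \<longlongrightarrow> (if P then y else 0)) F"
    if "(f \<longlongrightarrow> y) F" for P and f :: "_ \<Rightarrow> real" and y
    using that by simp
  show ?case unfolding 1 2
    by (intro tendsto_sum tendsto_mult tendsto_add if_lim tendsto_diff tendsto_const Game.IH Game.prems)
      (use Game.prems in auto)
qed auto

lemma sum_pmf_champion: "(\<Sum>i\<in>teams T. pmf (champion p T) i) = 1"
  by (rule sum_pmf_eq_1) (simp_all add: set_pmf_champion)

text \<open>Every possible opponent from \<open>r\<close> is beaten with the same chance \<delta>,
  so the distribution of the opponent sums to one and drops out.\<close>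

lemma pmf_champion_factor_step:
  assumes k: "k \<in> teams l" "k \<notin> teams r"
    and range: "\<And>i j. i \<in> teams l \<Longrightarrow> j \<in> teams r \<Longrightarrow> 0 \<le> p i j \<and> p i j \<le> 1"
    and const: "\<And>j. j \<in> teams r \<Longrightarrow> p k j = \<delta>"
  shows "pmf (champion p (Game l r)) k = \<delta> * pmf (champion p l) k"
proof -
  have "pmf (champion p (Game l r)) k = (\<Sum>i\<in>teams l. if k = i then
      (\<Sum>j\<in>teams r. pmf (champion p l) k * pmf (champion p r) j * \<delta>) else 0)"
  proof (subst pmf_champion_Game[OF range])
    show "(\<Sum>i\<in>teams l. \<Sum>j\<in>teams r. pmf (champion p l) i * pmf (champion p r) j *
        ((if k = i then p i j else 0) + (if k = j then 1 - p i j else 0))) =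
      (\<Sum>i\<in>teams l. if k = i then
        (\<Sum>j\<in>teams r. pmf (champion p l) k * pmf (champion p r) j * \<delta>) else 0)"
    proof (rule sum.cong[OF refl])
      fix i
      have "pmf (champion p l) i * pmf (champion p r) j *
          ((if k = i then p i j else 0) + (if k = j then 1 - p i j else 0)) =
          (if k = i then pmf (champion p l) k * pmf (champion p r) j * \<delta> else 0)"
        if "j \<in> teams r" for j
        using that k const by auto
      then show "(\<Sum>j\<in>teams r. pmf (champion p l) i * pmf (champion p r) j *
          ((if k = i then p i j else 0) + (if k = j then 1 - p i j else 0))) =
          (if k = i then (\<Sum>j\<in>teams r. pmf (champion p l) k * pmf (champion p r) j * \<delta>) else 0)"
        by simp
    qed
  qed auto
  also have "\<dots> = (\<Sum>j\<in>teams r. pmf (champion p l) k * pmf (champion p r) j * \<delta>)"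
    using k by simp
  also have "\<dots> = pmf (champion p l) k * (\<Sum>j\<in>teams r. pmf (champion p r) j) * \<delta>"
    by (simp add: sum_distrib_left sum_distrib_right)
  finally show ?thesis by (simp add: sum_pmf_champion)
qed

text \<open>All teams of \<open>U\<close> climb the same path to the root, and each game on it
  contributes a factor \<delta>. The constant is a power of \<delta> that does not depend on the
  team.\<close>

lemma pmf_champion_factor:
  assumes "distinct (leaves S)" "U \<in> set (slice d S)" "0 < \<delta>"
    and "\<And>i j. i \<in> teams S \<Longrightarrow> j \<in> teams S \<Longrightarrow> 0 \<le> p i j \<and> p i j \<le> 1 \<and> p i j + p j i = 1"
    and "\<And>k x. k \<in> teams U \<Longrightarrow> x \<in> teams S - teams U \<Longrightarrow> p k x = \<delta>"
  shows "\<exists>c>0. \<forall>k\<in>teams U. pmf (champion p S) k = c * pmf (champion p U) k"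
  using assms
proof (induction d S rule: slice.induct)
  case (1 T)
  then show ?case by (auto intro: exI[of _ 1])
next
  case (2 d i)
  then show ?case by (auto intro: exI[of _ 1])
next
  case (3 d l r)
  have dis: "teams l \<inter> teams r = {}" "distinct (leaves l)" "distinct (leaves r)"
    using 3(3) unfolding distinct_leaves_Game by blast+
  have step: "\<exists>c>0. \<forall>k\<in>teams U. pmf (champion p (Game l' r')) k = c * pmf (champion p U) k"
    if IH: "\<exists>c>0. \<forall>k\<in>teams U. pmf (champion p l') k = c * pmf (champion p U) k"
      and U: "U \<in> set (slice d l')" and lr: "l' = l \<and> r' = r \<or> l' = r \<and> r' = l" for l' r'
  proof -
    obtain c where c: "c > 0" "\<And>k. k \<in> teams U \<Longrightarrow> pmf (champion p l') k = c * pmf (champion p U) k"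
      using IH by blast
    have sub: "teams U \<subseteq> teams l'" using U teams_slice[of l' d] by auto
    have "pmf (champion p (Game l' r')) k = \<delta> * pmf (champion p l') k" if "k \<in> teams U" for k
    proof (rule pmf_champion_factor_step)
      show "k \<in> teams l'" "k \<notin> teams r'" using that sub dis lr by auto
      show "0 \<le> p i j \<and> p i j \<le> 1" if "i \<in> teams l'" "j \<in> teams r'" for i j
        using that lr 3(6)[of i j] by auto
      show "p k j = \<delta>" if "j \<in> teams r'" for j
      proof -
        have "j \<notin> teams U" using that sub dis lr by blast
        then show ?thesis using 3(7)[OF \<open>k \<in> teams U\<close>, of j] that lr by auto
      qed
    qed
    then show ?thesis using c \<open>0 < \<delta>\<close> by (intro exI[of _ "\<delta> * c"]) auto
  qed
  consider "U \<in> set (slice d l)" | "U \<in> set (slice d r)" using 3(4) by auto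
  then show ?case
  proof cases
    case 1
    have "\<exists>c>0. \<forall>k\<in>teams U. pmf (champion p l) k = c * pmf (champion p U) k"
      by (rule "3.IH"(1)[OF dis(2) 1 3(5)]) (use 3(6,7) in auto)
    then show ?thesis using step[of l r] 1 by blast
  next
    case 2
    have "\<exists>c>0. \<forall>k\<in>teams U. pmf (champion p r) k = c * pmf (champion p U) k"
      by (rule "3.IH"(2)[OF dis(3) 2 3(5)]) (use 3(6,7) in auto)
    moreover have "champion p (Game l r) = champion p (Game r l)"
      using 3(6) by (intro champion_commute) simp
    ultimately show ?thesis using step[of r l] 2 by simp
  qed
qed

section \<open>The embedded matchup table\<close>

text \<open>Seeds up to m are the top teams and seeds m + 1, ..., m + n play according to p; the common
  summand e/2 keeps their chances against each other at least as large as those against a top team,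
  as SST demands.\<close>
definition embed_table :: "nat \<Rightarrow> nat \<Rightarrow> (nat \<Rightarrow> nat \<Rightarrow> real) \<Rightarrow> real \<Rightarrow> nat \<Rightarrow> nat \<Rightarrow> real" where
  "embed_table m n p e i j =
    (if i \<le> m then (if j \<le> m then 1 / 2 else 1 - e / 2)
     else if j \<le> m then e / 2
     else if i \<le> m + n then (if j \<le> m + n then (1 - e) * p (i - m) (j - m) + e / 2 else 1 - e / 2)
     else (if j \<le> m + n then e / 2 else 1 / 2))"

text \<open>The bounds are the chances of a team of the copy against a top seed and against a seed
  beyond \<open>m + n\<close>, so its row stays monotone across the borders of the block.\<close>

lemma mixture_bounds:
  fixes x e :: real
  assumes "0 \<le> x" "x \<le> 1" "0 \<le> e" "e \<le> 1"
  shows "e / 2 \<le> (1 - e) * x + e / 2" "(1 - e) * x + e / 2 \<le> 1 - e / 2"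
proof -
  show "e / 2 \<le> (1 - e) * x + e / 2" using assms by simp
  have "(1 - e) * x \<le> (1 - e) * 1" using assms by (intro mult_left_mono) auto
  then show "(1 - e) * x + e / 2 \<le> 1 - e / 2" by (simp add: field_simps)
qed

lemma embed_table_range:
  assumes "matchup_table n p" "0 \<le> e" "e \<le> 1"
  shows "0 \<le> embed_table m n p e i j \<and> embed_table m n p e i j \<le> 1 \<and>
    embed_table m n p e i j + embed_table m n p e j i = 1"
proof (cases "m < i \<and> i \<le> m + n \<and> m < j \<and> j \<le> m + n")
  case True
  then have ij: "i - m \<in> {1..n}" "j - m \<in> {1..n}" by auto
  have p: "0 \<le> p (i - m) (j - m)" "p (i - m) (j - m) \<le> 1" "p (j - m) (i - m) = 1 - p (i - m) (j - m)"
    using bspec[OF bspec[OF assms(1)[unfolded matchup_table_def] ij(1)] ij(2)] by linarith+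
  show ?thesis
    using True mixture_bounds[OF p(1,2) assms(2,3)] assms(2,3)
    by (simp add: embed_table_def p(3) algebra_simps)
next
  case False
  then show ?thesis using assms(2,3) by (auto simp: embed_table_def)
qed

text \<open>Rows of top seeds step from 1/2 up to \<open>1 - e / 2\<close>, rows of the lowest seeds
  from \<open>e / 2\<close> up to 1/2. Only the rows of the copy draw on the transitivity of
  \<open>p\<close>.\<close>

lemma embed_table_SST:
  assumes table: "matchup_table n p" and SST: "SST n p" and e: "0 \<le> e" "e \<le> 1"
  shows "SST N (embed_table m n p e)"
proof -
  have "embed_table m n p e i j \<le> embed_table m n p e i k" if "j < k" for i j k
  proof (cases "m < i \<and> i \<le> m + n")
    case i: True
    have p: "0 \<le> p (i - m) x" "p (i - m) x \<le> 1" if "x \<in> {1..n}" for x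
    proof -
      have "i - m \<in> {1..n}" using i by auto
      then show "0 \<le> p (i - m) x" "p (i - m) x \<le> 1"
        using table that unfolding matchup_table_def by blast+
    qed
    have b: "e / 2 \<le> (1 - e) * p (i - m) x + e / 2" "(1 - e) * p (i - m) x + e / 2 \<le> 1 - e / 2"
      if "x \<in> {1..n}" for x
      using mixture_bounds[OF p[OF that] e] by blast+
    consider "k \<le> m" | "j \<le> m" "m < k" "k \<le> m + n" | "j \<le> m" "m + n < k"
      | "m < j" "k \<le> m + n" | "m < j" "j \<le> m + n" "m + n < k" | "m + n < j"
      using \<open>j < k\<close> by linarith
    then show ?thesis
    proof cases
      case 2
      then have "k - m \<in> {1..n}" by auto
      then show ?thesis using 2 i b(1)[of "k - m"] by (simp add: embed_table_def)
    next
      case 4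
      then have "i - m \<in> {1..n}" "j - m \<in> {1..n}" "k - m \<in> {1..n}" "j - m < k - m"
        using i \<open>j < k\<close> by auto
      then have "p (i - m) (j - m) \<le> p (i - m) (k - m)" using SST unfolding SST_def by blast
      then have "(1 - e) * p (i - m) (j - m) \<le> (1 - e) * p (i - m) (k - m)"
        using e by (intro mult_left_mono) auto
      then show ?thesis using 4 i \<open>j < k\<close> by (simp add: embed_table_def)
    next
      case 5
      then have "j - m \<in> {1..n}" by auto
      then show ?thesis using 5 i b(2)[of "j - m"] by (simp add: embed_table_def)
    qed (use i e \<open>j < k\<close> in \<open>auto simp: embed_table_def\<close>)
  next
    case False
    then show ?thesis using e \<open>j < k\<close> by (auto simp: embed_table_def)
  qed
  then show ?thesis by (simp add: SST_def)
qed

section \<open>The copy inside the larger bracket\<close>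

lemma num_alive_0: "is_bracket T \<Longrightarrow> num_alive T 0 = num_teams T"
  using card_alive[of T 0] by (simp add: alive_0 is_bracket_def)

text \<open>Induction on rounds. Seeds of opponents add up to 2 N + 1 in both brackets, and the two
  values of N differ by \<open>m\<close>. So two games whose chalk winners differ by
  \<open>m\<close> have children that match in the same way, and any game of \<open>S\<close> facing
  a leaf of \<open>T\<close> is against sure losers, as \<open>e\<close> is 0 here.\<close>

lemma slice_champion_eq:
  assumes S: "is_bracket S" "proper S" and T: "is_bracket T" "proper T"
    and ir: "i + rounds T \<le> rounds S"
    and later: "\<And>j. 0 < j \<Longrightarrow> j \<le> rounds T \<Longrightarrow> num_alive S (i + j) = m + num_alive T j"
    and first: "m + num_alive T 0 \<le> num_alive S i"
    and p: "matchup_table (num_teams T) p"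
  defines "q \<equiv> embed_table m (num_teams T) p 0"
  shows "j \<le> rounds T \<Longrightarrow> U \<in> set (slice (rounds S - (i + j)) S) \<Longrightarrow>
    V \<in> set (slice (rounds T - j) T) \<Longrightarrow> chalk_winner U = m + chalk_winner V \<Longrightarrow>
    champion q U = map_pmf ((+) m) (champion p V)"
proof (induction j arbitrary: U V)
  case 0
  let ?n = "num_teams T"
  have distS: "distinct (leaves S)" using S by (simp add: is_bracket_def)
  have teamsT: "teams T = {1..?n}" using T by (simp add: is_bracket_def)
  obtain v where V: "V = Team v" "v \<in> {1..?n}"
    using 0 slice_deep[of T "rounds T"] teamsT by auto
  \<comment> \<open>All seeds up to \<open>m + ?n\<close> are alive after round \<open>i\<close>, so
    each is the chalk winner of a subtree of its own, and \<open>U\<close> contains only one of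
    them.\<close>
  have big: "m + ?n < x" if x: "x \<in> teams U" "x \<noteq> m + v" for x
  proof (rule ccontr)
    assume "\<not> m + ?n < x"
    moreover have "1 \<le> x"
      using x(1) chalk_winner_le[OF x(1)] 0 V by simp
    ultimately have "x \<in> alive S i"
      using alive_proper[OF S, of i] ir first num_alive_0[OF T(1)] by simp
    then obtain W where W: "W \<in> set (slice (rounds S - i) S)" "x = chalk_winner W"
      by (auto simp: alive_def)
    then have "W = U"
      using slice_unique[OF distS W(1), of U x] 0 x chalk_winner_in_teams[of W] by simp
    then show False using W x(2) 0 V by simp
  qed
  have "champion q U = return_pmf (m + v)"
  proof (rule champion_dominant)
    show "distinct (leaves U)" using slice_distinct[OF distS] 0 by simp
    show "m + v \<in> teams U" using 0 V chalk_winner_in_teams[of U] by simp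
    show "q (m + v) x = 1" if "x \<in> teams U" "x \<noteq> m + v" for x
      using big[OF that] V by (simp add: q_def embed_table_def)
    show "0 \<le> q i j \<and> q i j \<le> 1 \<and> q i j + q j i = 1" for i j
      unfolding q_def by (rule embed_table_range[OF p]) auto
  qed
  then show ?case using V by simp
next
  case (Suc j)
  let ?n = "num_teams T"
  have flip: "champion q (Game l r) = champion q (Game r l)" for l r
    unfolding q_def by (rule champion_commute, rule embed_table_range[OF p]) auto
  have teamsT: "teams T = {1..?n}" using T by (simp add: is_bracket_def)
  have jS: "i + j < rounds S" and jT: "j < rounds T" using Suc.prems(1) ir by auto
  have NSuc: "num_alive S (Suc (i + j)) = m + num_alive T (Suc j)"
    using later[of "Suc j"] Suc.prems(1) by simp
  have Nle: "m + num_alive T j \<le> num_alive S (i + j)"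
    using later[of j] first Suc.prems(1) by (cases "j = 0") auto
  note fS = proper_round_facts[OF S jS] and fT = proper_round_facts[OF T jT]
  have U: "U \<in> set (slice (rounds S - Suc (i + j)) S)" using Suc.prems(2) by simp
  note V = Suc.prems(3)
  have Sslice: "rounds S - (i + j) = Suc (rounds S - Suc (i + j))"
    and Tslice: "rounds T - j = Suc (rounds T - Suc j)" using jS jT by auto
  have IH: "champion q U' = map_pmf ((+) m) (champion p V')"
    if "U' \<in> set (slice (Suc (rounds S - Suc (i + j))) S)"
      "V' \<in> set (slice (Suc (rounds T - Suc j)) T)" "chalk_winner U' = m + chalk_winner V'" for U' V'
    by (rule Suc.IH) (use that jT in \<open>simp_all add: Sslice Tslice\<close>)
  show ?case
  proof (cases U)
    case UT: (Team x)
    \<comment> \<open>The bye bound 2 N(s + 1) - N(s) for \<open>S\<close> is at most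
      \<open>m\<close> plus the one for \<open>T\<close>, so a bye in \<open>S\<close> cannot face a
      game in \<open>T\<close>.\<close>
    have "\<not> is_Game V"
    proof
      assume "is_Game V"
      then obtain l r where "V = Game l r" by (cases V) auto
      then show False
        using fT(2)[of l r] fS(3)[of x] U V UT Suc.prems(4) NSuc Nle by simp
    qed
    then obtain y where "V = Team y" by (cases V) auto
    then show ?thesis using UT Suc.prems(4) by simp
  next
    case UG: (Game l r)
    have lr_in: "l \<in> set (slice (Suc (rounds S - Suc (i + j))) S)"
      "r \<in> set (slice (Suc (rounds S - Suc (i + j))) S)"
      using U UG unfolding slice_Suc_iff by blast+
    have lr_sum: "chalk_winner l + chalk_winner r = 2 * (m + num_alive T (Suc j)) + 1"
      using fS(1)[of l r] U UG NSuc by simp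
    show ?thesis
    proof (cases V)
      case VG: (Game l' r')
      have lr'_in: "l' \<in> set (slice (Suc (rounds T - Suc j)) T)"
        "r' \<in> set (slice (Suc (rounds T - Suc j)) T)"
        using V VG unfolding slice_Suc_iff by blast+
      have sub: "teams l' \<union> teams r' \<subseteq> {1..?n}"
        using V VG teams_slice[of T "rounds T - Suc j"] teamsT by auto
      have q: "q (m + a) (m + b) = p a b" if "a \<in> teams l' \<union> teams r'" "b \<in> teams l' \<union> teams r'" for a b
        using subsetD[OF sub that(1)] subsetD[OF sub that(2)] by (simp add: q_def embed_table_def)
      have lr'_sum: "chalk_winner l' + chalk_winner r' = 2 * num_alive T (Suc j) + 1"
        using fT(1)[of l' r'] V VG by simp
      have "min (chalk_winner l) (chalk_winner r) = m + min (chalk_winner l') (chalk_winner r')"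
        using Suc.prems(4) UG VG by simp
      \<comment> \<open>Minima that differ by \<open>m\<close> and sums that differ by
        \<open>2 * m\<close> force the two pairs to match, possibly crosswise.\<close>
      then consider "chalk_winner l = m + chalk_winner l'" "chalk_winner r = m + chalk_winner r'"
        | "chalk_winner l = m + chalk_winner r'" "chalk_winner r = m + chalk_winner l'"
        using lr_sum lr'_sum by (auto simp: min_def split: if_splits)
      then show ?thesis
      proof cases
        case 1
        show ?thesis unfolding UG VG
          by (rule champion_map_Game) (use IH lr_in lr'_in 1 q in auto)
      next
        case 2
        show ?thesis unfolding UG VG flip[of l r]
          by (rule champion_map_Game) (use IH lr_in lr'_in 2 q in auto)
      qed
    next
      case VT: (Team v)
      have v: "num_alive T j + v \<le> 2 * num_alive T (Suc j)"
        using fT(3)[of v] V VT by simp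
      have "2 * num_alive S (Suc (i + j)) < num_alive S (i + j) + (m + v)"
        using fS(2)[of l r] U UG Suc.prems(4) VT by simp
      \<comment> \<open>For \<open>j > 0\<close> the two bye bounds differ by exactly
        \<open>m\<close>, so an extra game can occur in the first round only.\<close>
      then have j0: "j = 0" using v NSuc later[of j] jT by (cases j) auto
      have "v \<in> teams V" using VT by simp
      then have v_in: "v \<in> {1..?n}" using V teams_slice[of T "rounds T - Suc j"] teamsT by blast
      have Vin: "V \<in> set (slice (Suc (rounds T - Suc j)) T)"
        using V VT unfolding slice_Suc_iff by simp
      have win: "champion q (Game a b) = return_pmf (m + v)"
        if a: "a \<in> set (slice (Suc (rounds S - Suc (i + j))) S)" "chalk_winner a = m + v"
          and b: "chalk_winner a + chalk_winner b = 2 * (m + num_alive T (Suc j)) + 1" for a b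
      proof (rule champion_bye)
        show "champion q a = return_pmf (m + v)" using IH[OF a(1) Vin] a(2) VT by simp
        fix x assume "x \<in> teams b"
        \<comment> \<open>The opponent has seed m + 2 N(1) + 1 - v, with N(1) taken in
          \<open>T\<close>. As \<open>v\<close> has a bye there, v is at most 2 N(1) - n, so this
          seed exceeds m + n.\<close>
        then have "m + ?n < x"
          using chalk_winner_le[of x b] a(2) b v num_alive_0[OF T(1)] j0 by simp
        then show "q (m + v) x = 1" using v_in by (simp add: q_def embed_table_def)
      qed
      have "min (chalk_winner l) (chalk_winner r) = m + v" using Suc.prems(4) UG VT by simp
      then consider "chalk_winner l = m + v" | "chalk_winner r = m + v"
        by (auto simp: min_def split: if_splits)
      then have "champion q U = return_pmf (m + v)"
      proof cases
        case 1
        then show ?thesis unfolding UG using win lr_in lr_sum by blast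
      next
        case 2
        then show ?thesis unfolding UG flip[of l r] using win lr_in lr_sum by (simp add: add.commute)
      qed
      then show ?thesis using VT by simp
    qed
  qed
qed

section \<open>Short brackets and transfer of the violation\<close>

text \<open>With two teams, SST gives \<open>1 / 2 = p 1 1 \<le> p 1 2\<close>. The lemma ensures
  that a contained bracket which is not ordered has at least two rounds, so its final falls under
  the exact clause of containment.\<close>

lemma ordered_one_round:
  assumes "is_bracket T" "rounds T \<le> 1"
  shows "ordered T"
proof (cases T)
  case (Team a)
  then show ?thesis by (simp add: ordered_def ordered_format_def num_teams_def)
next
  case (Game l r)
  then obtain a b where ab: "l = Team a" "r = Team b" using assms(2) by (cases l; cases r) auto
  have set: "{a, b} = {1..2}" and "a \<noteq> b"
    using assms(1) Game ab by (auto simp: is_bracket_def num_teams_def teams_def numeral_2_eq_2)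
  have n: "num_teams T = 2" using Game ab by (simp add: num_teams_def)
  have "{1..2} = {1, 2::nat}" by auto
  with set have ab12: "a = 1 \<and> b = 2 \<or> a = 2 \<and> b = 1" by (auto simp: doubleton_eq_iff)
  have "pmf (champion p T) j \<le> pmf (champion p T) i"
    if p: "matchup_table 2 p" "SST 2 p" and ij: "i \<in> {1..2}" "j \<in> {1..2}" "i < j" for p i j
  proof -
    have i: "i = 1" "j = 2" using ij by auto
    have p12: "0 \<le> p 1 2" "p 1 2 \<le> 1" "p 2 1 = 1 - p 1 2" "p 1 1 = 1 / 2"
      using p(1)[unfolded matchup_table_def, THEN bspec[of _ _ 1], THEN bspec[of _ _ 2]]
        p(1)[unfolded matchup_table_def, THEN bspec[of _ _ 1], THEN bspec[of _ _ 1]] by auto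
    have "p 1 1 \<le> p 1 2" using p(2) by (auto simp: SST_def)
    then have half: "1 / 2 \<le> p 1 2" using p12 by simp
    show ?thesis using ab12 p12 half unfolding Game ab i
      by (auto simp: bind_return_pmf pmf_bind)
  qed
  then show ?thesis unfolding ordered_def ordered_format_def n by blast
qed

theorem lemma2p4p6:
  fixes \<A> \<B> :: "nat list" and S T :: bracket
  assumes "proper_bracket_of \<A> S"
    and "proper_bracket_of \<B> T"
    and "sig_contains \<A> \<B>"
    and "\<not> ordered T"
  shows "\<not> ordered S"
proof
  assume "ordered S"
  have S: "is_bracket S" "proper S" "signature S = \<A>" and T: "is_bracket T" "proper T" "signature T = \<B>"
    using assms(1,2) by (auto simp: proper_bracket_of_def)
  define r where "r = rounds T"
  define n where "n = num_teams T"
  have distS: "distinct (leaves S)" using S by (simp add: is_bracket_def)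
  have r2: "2 \<le> r" using ordered_one_round[OF T(1)] assms(4) unfolding r_def by linarith
  have "sig_rounds \<B> = r" using T(3) by (auto simp: sig_rounds_def signature_def r_def)
  then obtain i where i1: "length (games_of_round T 1) \<le> length (games_of_round S (i + 1))"
    and ij: "\<And>j. 1 < j \<Longrightarrow> j \<le> r \<Longrightarrow>
      length (games_of_round S (i + j)) = length (games_of_round T j)"
    using assms(3) sig_games_signature[OF S(1)] sig_games_signature[OF T(1)] S(3) T(3)
    unfolding sig_contains_def by metis
  \<comment> \<open>The final is a single game, so round \<open>i + r\<close> of \<open>S\<close>
    has one game as well and in particular exists, because \<open>games_of_round\<close> is empty
    beyond the last round.\<close>
  have final: "length (games_of_round T r) = 1"
    using r2 unfolding r_def by (cases T) (auto simp: games_of_round_def)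
  then have "length (games_of_round S (i + r)) = 1" using ij[of r] r2 by simp
  then have ir: "i + r \<le> rounds S" by (simp add: games_of_round_def split: if_splits)
  \<comment> \<open>\<open>m\<close> counts the survivors of round \<open>i + r\<close> other than
    the winner of its only game.\<close>
  define m where "m = num_alive S (i + r) - 1"
  have "slice d S \<noteq> []" for d
    using chalk_winner_in_teams[of S] teams_slice[of S d] by auto
  then have Nr: "num_alive S (i + r) = m + 1" by (simp add: m_def num_alive_def)
  \<comment> \<open>Counting back from the final, each round restores as many teams as it has games,
    equally many in both brackets.\<close>
  have later: "num_alive S (i + j) = m + num_alive T j" if "0 < j" "j \<le> r" for j
    using that(2,1)
  proof (induction j rule: inc_induct)
    case base
    then show ?case using Nr num_alive_rounds[of T] by (simp add: r_def)
  next
    case (step k)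
    then show ?case
      using num_alive_step[of "i + k" S] num_alive_step[of k T] ij[of "Suc k"] ir
      by (simp add: r_def)
  qed
  \<comment> \<open>Round \<open>i + 1\<close> of \<open>S\<close> may have extra games, which
    leaves only an inequality.\<close>
  have first: "m + num_alive T 0 \<le> num_alive S i"
    using num_alive_step[of i S] num_alive_step[of 0 T] i1 later[of 1] ir r2 by (simp add: r_def)
  \<comment> \<open>This makes the bye bound of round \<open>i + r\<close> equal to
    \<open>2 * (m + 1) - (m + 2) = m\<close>.\<close>
  have prev: "num_alive S (i + (r - 1)) = m + 2"
    using num_alive_step[of "r - 1" T] num_alive_rounds[of T] final later[of "r - 1"] r2
    by (simp add: r_def)
  obtain p a b where p: "matchup_table n p" "SST n p"
    and ab: "a \<in> {1..n}" "b \<in> {1..n}" "a < b"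
    and bad: "pmf (champion p T) a < pmf (champion p T) b"
    using assms(4) unfolding ordered_def ordered_format_def n_def by (auto simp: not_le)
  let ?F = "set (slice (rounds S - (i + r)) S)"
  have "m + 1 \<in> alive S (i + r)" using alive_proper[OF S(1,2) ir] Nr by simp
  then obtain U where U: "U \<in> ?F" "chalk_winner U = m + 1" by (auto simp: alive_def)
  \<comment> \<open>A leaf of this slice carries a seed up to \<open>m\<close>. A game has a chalk
    winner above \<open>m\<close> that is alive, hence equal to \<open>m + 1\<close>, so it is
    \<open>U\<close>.\<close>
  have others: "x \<le> m" if "x \<in> teams S" "x \<notin> teams U" for x
  proof -
    obtain W where W: "W \<in> ?F" "x \<in> teams W"
      using \<open>x \<in> teams S\<close> teams_slice[of S "rounds S - (i + r)"] by auto
    have s: "i + (r - 1) < rounds S" "Suc (i + (r - 1)) = i + r" using ir r2 by auto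
    note facts = proper_round_facts[OF S(1,2) s(1), unfolded s(2) Nr prev]
    show ?thesis
    proof (cases W)
      case (Team y)
      then show ?thesis using facts(3)[of y] W by simp
    next
      case (Game l r')
      have "chalk_winner W \<in> alive S (i + r)" using W by (auto simp: alive_def)
      then have "chalk_winner W \<le> m + 1" using alive_proper[OF S(1,2) ir] Nr by simp
      moreover have "m < chalk_winner W" using facts(2)[of l r'] W Game by simp
      ultimately have "chalk_winner W = chalk_winner U" using U by simp
      then have "W = U"
        using slice_unique[OF distS W(1) U(1), of "m + 1"] U(2) chalk_winner_in_teams[of W]
          chalk_winner_in_teams[of U] by simp
      then show ?thesis using W that by simp
    qed
  qed
  have "m + n \<le> num_teams S"
  proof -
    have "alive S i \<subseteq> teams S"
      using chalk_winner_in_teams teams_slice[of S "rounds S - i"] by (auto simp: alive_def)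
    then have "card (alive S i) \<le> num_teams S"
      using S(1) card_mono[of "teams S" "alive S i"] by (simp add: is_bracket_def)
    then show ?thesis using first card_alive[OF distS, of i] num_alive_0[OF T(1)] by (simp add: n_def)
  qed
  then have inS: "m + k \<in> teams S" if "k \<in> {1..n}" for k
    using that S(1) by (auto simp: is_bracket_def)
  then have inU: "m + k \<in> teams U" if "k \<in> {1..n}" for k
    using others[of "m + k"] that by fastforce
  let ?q = "\<lambda>e. embed_table m n p e"
  have "champion (?q 0) U = map_pmf ((+) m) (champion p T)"
  proof -
    have TT: "T \<in> set (slice (rounds T - r) T)" by (simp add: r_def)
    have "chalk_winner T = 1"
      using alive_proper[OF T(1,2), of r] num_alive_rounds[of T] by (auto simp: alive_def r_def)
    then show ?thesis
      using slice_champion_eq[OF S(1,2) T(1,2) ir[unfolded r_def] _ first p(1)[unfolded n_def],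
          of r U T] later U TT by (simp add: n_def r_def)
  qed
  then have q0: "pmf (champion (?q 0) U) (m + k) = pmf (champion p T) k" for k
    using pmf_map_inj'[of "(+) m"] by simp
  \<comment> \<open>Positive values keep the factor \<open>e / 2\<close> positive, and values up to
    1 keep the mixture a matchup table.\<close>
  let ?e = "\<lambda>N::nat. inverse (real (Suc N))"
  have e: "0 < ?e N" "?e N \<le> 1" for N by (simp_all add: field_simps)
  have lim: "(\<lambda>N. pmf (champion (?q (?e N)) U) k) \<longlonglongrightarrow> pmf (champion (?q 0) U) k" for k
  proof (rule tendsto_pmf_champion)
    fix x y
    have "((\<lambda>e. ?q e x y) \<longlongrightarrow> ?q 0 x y) (at 0)"
      unfolding embed_table_def by (auto intro!: tendsto_eq_intros)
    moreover have "filterlim ?e (at 0) sequentially"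
      using LIMSEQ_inverse_real_of_nat by (auto simp: filterlim_at)
    ultimately show "(\<lambda>N. ?q (?e N) x y) \<longlonglongrightarrow> ?q 0 x y" by (rule filterlim_compose)
    show "0 \<le> ?q 0 x y \<and> ?q 0 x y \<le> 1" using embed_table_range[OF p(1), of 0 m x y] by simp
    show "0 \<le> ?q (?e N) x y \<and> ?q (?e N) x y \<le> 1" for N
      using embed_table_range[OF p(1) less_imp_le[OF e(1)] e(2)] by blast
  qed
  have "(\<lambda>N. pmf (champion (?q (?e N)) U) (m + b) - pmf (champion (?q (?e N)) U) (m + a))
      \<longlonglongrightarrow> pmf (champion p T) b - pmf (champion p T) a"
    unfolding q0[symmetric] by (intro tendsto_diff lim)
  then have "eventually (\<lambda>N. 0 < pmf (champion (?q (?e N)) U) (m + b) - pmf (champion (?q (?e N)) U) (m + a)) sequentially"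
    using bad by (intro order_tendstoD) auto
  then obtain N where N: "pmf (champion (?q (?e N)) U) (m + a) < pmf (champion (?q (?e N)) U) (m + b)"
    by (auto simp: eventually_sequentially)
  define q where "q = ?q (?e N)"
  have range: "0 \<le> q x y \<and> q x y \<le> 1 \<and> q x y + q y x = 1" for x y
    unfolding q_def by (rule embed_table_range[OF p(1) less_imp_le[OF e(1)] e(2)])
  have "\<exists>c>0. \<forall>k\<in>teams U. pmf (champion q S) k = c * pmf (champion q U) k"
  proof (rule pmf_champion_factor[OF distS U(1)])
    show "0 < ?e N / 2" by simp
    \<comment> \<open>Seeds in \<open>U\<close> are at least its chalk winner \<open>m + 1\<close>,
      and all seeds outside are at most \<open>m\<close>.\<close>
    show "q k x = ?e N / 2" if "k \<in> teams U" "x \<in> teams S - teams U" for k x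
      using others[of x] that chalk_winner_le[OF that(1)] U(2) by (simp add: q_def embed_table_def)
  qed (rule range)
  then have "pmf (champion q S) (m + a) < pmf (champion q S) (m + b)"
    using N inU ab by (auto simp: q_def)
  moreover have "matchup_table (num_teams S) q" "SST (num_teams S) q"
    using range embed_table_SST[OF p less_imp_le[OF e(1)] e(2)] by (auto simp: matchup_table_def q_def)
  moreover have "m + a \<in> {1..num_teams S}" "m + b \<in> {1..num_teams S}" "m + a < m + b"
    using inS ab S(1) by (auto simp: is_bracket_def)
  ultimately show False
    using \<open>ordered S\<close> unfolding ordered_def ordered_format_def by (meson not_le)
qed

end
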